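(* Let $r$ be an odd prime number, $m$ a positive integer, $N>1$ an integer with $N\mid (r^m-1)$. Let $q$ be a power of $p=2$ with $N\mid (q-1)$. Let $\varphi:\mathbb{F}_{r^m}^*\to\mathbb{F}_q^*$ be the homomorphism of order $N$ defined in the context, let $P$ be the $r^m\times r^m$ matrix over $\mathbb{F}_q$ defined in the context with diagonal value $v=1$, and let $C=C_{(\varphi,1)}$ be the linear code over $\mathbb{F}_q$ with generator matrix $[I_{r^m},P]$. Then $C$ is a $[2r^m,r^m]$ linear code over $\mathbb{F}_q$ with one-dimensional hull.
   Context: Fix a primitive element $\alpha$ of $\mathbb{F}_{r^m}$ and a primitive element $\beta$ of $\mathbb{F}_q$, and put $u=\beta^{(q-1)/N}$. Define $\varphi:\mathbb{F}_{r^m}^*\to\mathbb{F}_q^*$ by $\varphi(\alpha^k)=u^k$ for $0\le k\le r^m-2$; this is a group homomorphism of order $N$. Enumerate $\mathbb{F}_{r^m}=\{x_i:1\le i\le r^m\}$. For $v\in\mathbb{F}_q$, $P=(p_{ij})$ is the $r^m\times r^m$ matrix over $\mathbb{F}_q$ with $p_{ij}=\varphi(x_j-x_i)$ for $i\ne j$ and $p_{ii}=v$. $C_{(\varphi,v)}$ denotes the linear code over $\mathbb{F}_q$ generated by the rows of $[I_{r^m},P]$. An $[n,k]$ linear code over $\mathbb{F}_q$ is a $k$-dimensional subspace of $\mathbb{F}_q^n$; $C^\perp$ is its dual for the inner product $\langle u,w\rangle=\sum_i u_iw_i$. The hull of $C$ is $\mathrm{Hull}(C)=C\cap C^\perp$;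 "one-dimensional hull" means $\dim_{\mathbb{F}_q}\mathrm{Hull}(C)=1$. *)

theory Defs
  imports "HOL-Analysis.Analysis"
begin

definition primitive_element :: "'a::field \<Rightarrow> bool" where
  "primitive_element a \<longleftrightarrow> range (\<lambda>k::nat. a ^ k) = UNIV - {0}"

(* The map a^k |-> u^k for 0 <= k <= |F| - 2, with u = b^((|K| - 1) / N).
   The value at 0 is unspecified; it is never used below, since code matrices
   only evaluate phi at differences of distinct field elements. *)
definition phi :: "nat \<Rightarrow> 'a::{field,finite} \<Rightarrow> 'b::{field,finite} \<Rightarrow> 'a \<Rightarrow> 'b" where
  "phi N a b y =
     (let u = b ^ ((CARD('b) - 1) div N)
      in u ^ (THE k. k \<le> CARD('a) - 2 \<and> a ^ k = y))"

definition P_matrix :: "('a::field \<Rightarrow> 'b::field) \<Rightarrow> 'b \<Rightarrow> ('n \<Rightarrow> 'a) \<Rightarrow> 'b ^ 'n ^ 'n" where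
  "P_matrix f v x = (\<chi> i j. if i = j then v else f (x j - x i))"

(* The block matrix [A, B]: its columns are indexed by the disjoint sum of the
   two column index types. *)
definition join_cols :: "'b ^ 'n ^ 'k \<Rightarrow> 'b ^ 'm ^ 'k \<Rightarrow> 'b ^ ('n + 'm) ^ 'k" where
  "join_cols A B = (\<chi> i j. case j of Inl l \<Rightarrow> A $ i $ l | Inr l \<Rightarrow> B $ i $ l)"

definition code_of_matrix :: "'b::field ^ 'n ^ 'k \<Rightarrow> ('b ^ 'n) set" where
  "code_of_matrix G = vec.span (rows G)"

definition code_C ::
  "('a::field \<Rightarrow> 'b::field) \<Rightarrow> 'b \<Rightarrow> ('n::finite \<Rightarrow> 'a) \<Rightarrow> ('b ^ ('n + 'n)) set" where
  "code_C f v x = code_of_matrix (join_cols (mat 1) (P_matrix f v x))"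

definition is_linear_code :: "nat \<Rightarrow> nat \<Rightarrow> ('b::field ^ 'n) set \<Rightarrow> bool" where
  "is_linear_code n k C \<longleftrightarrow> CARD('n) = n \<and> vec.subspace C \<and> vec.dim C = k"

(* Bilinear, without conjugation: the library inner product is for real spaces only. *)
definition dual_code :: "('b::field ^ 'n) set \<Rightarrow> ('b ^ 'n) set" where
  "dual_code C = {w. \<forall>c\<in>C. (\<Sum>i\<in>UNIV. c $ i * w $ i) = 0}"

definition code_hull :: "('b::field ^ 'n) set \<Rightarrow> ('b ^ 'n) set" where
  "code_hull C = C \<inter> dual_code C"

end

theory Submission
  imports Defs
begin

text \<open>Extend the homomorphism by \<open>0\<close> at \<open>0\<close> to a multiplicative map \<open>\<eta>\<close>. In
  characteristic 2 the reflection \<open>k \<mapsto> a + b - k\<close> cancels all terms of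
  \<open>\<Sum>\<^sub>k \<eta> (k - a) * \<eta> (k - b)\<close> except the one at the midpoint, so the Gram matrix of the rows of
  \<open>[I, P]\<close> is a nonzero multiple of \<open>(\<psi> (x\<^sub>i - x\<^sub>j))\<close>, where \<open>\<psi> = \<eta>\<^sup>2\<close> is again
  nontrivial. Multiplying this matrix by the one built from \<open>1/\<psi>\<close> gives the matrix with
  \<open>0\<close> on the diagonal and \<open>1\<close> elsewhere. Hence the kernel consists of the constant vectors,
  and the hull is spanned by the sum of the rows.\<close>

section \<open>Finite fields and primitive elements\<close>

text \<open>The shift by 1 permutes the ring, so adding \<open>CARD('a)\<close> ones leaves the sum
  of all elements unchanged. This is the link from cardinality to characteristic.\<close>

lemma of_nat_CARD_eq_0: "of_nat CARD('a) = (0 :: 'a::{ring_1,finite})"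
proof -
  have "(\<Sum>y\<in>UNIV. y) = (\<Sum>y\<in>UNIV. y + 1 :: 'a)"
    by (rule sum.reindex_bij_betw[symmetric], rule bij_betwI[where g = "\<lambda>y. y - 1"]) auto
  then show ?thesis
    by (simp add: sum.distrib)
qed

lemma nonzero_power_CARD_minus_1:
  fixes a :: "'a::{field,finite}"
  assumes "a \<noteq> 0"
  shows "a ^ (CARD('a) - 1) = 1"
proof -
  let ?U = "UNIV - {0 :: 'a}"
  have "(\<Prod>y\<in>?U. y) = (\<Prod>y\<in>?U. a * y)"
    by (rule prod.reindex_bij_betw[symmetric], rule bij_betwI[where g = "\<lambda>y. y / a"])
      (use assms in auto)
  also have "\<dots> = a ^ card ?U * (\<Prod>y\<in>?U. y)"
    by (simp only: prod.distrib prod_constant)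
  finally have "a ^ card ?U = 1"
    by simp
  then show ?thesis
    by (simp add: card_Diff_singleton)
qed

lemma CARD_field_ge_2: "CARD('a::{field,finite}) \<ge> 2"
  using card_mono[of "UNIV :: 'a set" "{0, 1}"] by simp

lemma power_mod_exponent:
  fixes a :: "'a::monoid_mult"
  assumes "a ^ d = 1"
  shows "a ^ k = a ^ (k mod d)"
proof -
  have "a ^ k = a ^ (d * (k div d) + k mod d)"
    by simp
  also have "\<dots> = a ^ (k mod d)"
    by (simp only: power_add power_mult assms power_one mult_1_left)
  finally show ?thesis .
qed

lemma range_power_eq_lessThan:
  fixes a :: "'a::monoid_mult"
  assumes "a ^ d = 1" "d > 0"
  shows "range (\<lambda>k. a ^ k) = (\<lambda>k. a ^ k) ` {..<d}"
proof -
  have "a ^ k = a ^ (k mod d)" for k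
    using assms(1) by (rule power_mod_exponent)
  moreover have "k mod d \<in> {..<d}" for k
    using assms(2) by simp
  ultimately have "a ^ k \<in> (\<lambda>k. a ^ k) ` {..<d}" for k
    by (rule image_eqI)
  then show ?thesis
    by blast
qed

text \<open>The powers of \<open>a\<close> take at most \<open>d\<close> values, yet they exhaust
  the nonzero elements.\<close>

lemma primitive_element_order_ge:
  fixes a :: "'a::{field,finite}"
  assumes "primitive_element a" "a ^ d = 1" "d > 0"
  shows "CARD('a) - 1 \<le> d"
proof -
  have "UNIV - {0} = (\<lambda>k. a ^ k) ` {..<d}"
    using assms range_power_eq_lessThan[of a d] by (simp add: primitive_element_def)
  then have "card (UNIV - {0 :: 'a}) \<le> card {..<d}"
    by (metis card_image_le finite_lessThan)
  then show ?thesis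
    by (simp add: card_Diff_singleton)
qed

lemma primitive_element_nonzero: "primitive_element a \<Longrightarrow> a \<noteq> 0"
  unfolding primitive_element_def by (metis Diff_iff power_one_right rangeI singletonI)

lemma primitive_element_inj_on:
  fixes a :: "'a::{field,finite}"
  assumes "primitive_element a"
  shows "inj_on (\<lambda>k. a ^ k) {..<CARD('a) - 1}"
proof (rule eq_card_imp_inj_on)
  have "CARD('a) - 1 > 0"
    using CARD_field_ge_2[where 'a = 'a] by simp
  then have "(\<lambda>k. a ^ k) ` {..<CARD('a) - 1} = UNIV - {0}"
    using assms range_power_eq_lessThan[of a "CARD('a) - 1"]
      nonzero_power_CARD_minus_1[OF primitive_element_nonzero[OF assms]]
    by (simp add: primitive_element_def)
  then show "card ((\<lambda>k. a ^ k) ` {..<CARD('a) - 1}) = card {..<CARD('a) - 1}"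
    by (simp add: card_Diff_singleton)
qed simp

text \<open>Frees \<open>k\<close> from the range in \<open>phi\<close>, which makes
  multiplicativity visible. The base on the right has \<open>N\<close>-th power 1 and
  \<open>N\<close> divides \<open>CARD('a) - 1\<close>, so both sides depend only on
  \<open>k\<close> modulo \<open>CARD('a) - 1\<close>.\<close>

lemma phi_power:
  fixes a :: "'a::{field,finite}" and b :: "'b::{field,finite}"
  assumes a: "primitive_element a" and b: "b \<noteq> 0"
    and N: "N dvd CARD('a) - 1" "N dvd CARD('b) - 1"
  shows "phi N a b (a ^ k) = (b ^ ((CARD('b) - 1) div N)) ^ k"
proof -
  define u where "u = b ^ ((CARD('b) - 1) div N)"
  define d where "d = CARD('a) - 1"
  have d: "d > 0" "CARD('a) - 2 = d - 1"
    using CARD_field_ge_2[where 'a = 'a] by (auto simp: d_def)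
  have "u ^ N = 1"
    using N(2) nonzero_power_CARD_minus_1[OF b] by (simp add: u_def flip: power_mult)
  then have ud: "u ^ d = 1"
    using N(1) by (metis d_def dvd_def power_mult power_one)
  have ad: "a ^ d = 1"
    unfolding d_def using primitive_element_nonzero[OF a] by (rule nonzero_power_CARD_minus_1)
  have "(THE j. j \<le> CARD('a) - 2 \<and> a ^ j = a ^ k) = k mod d"
  proof (rule the_equality)
    have "k mod d < d"
      using d by simp
    then have "k mod d \<le> d - 1"
      by linarith
    then show *: "k mod d \<le> CARD('a) - 2 \<and> a ^ (k mod d) = a ^ k"
      using power_mod_exponent[OF ad, of k] d by simp
    fix j assume "j \<le> CARD('a) - 2 \<and> a ^ j = a ^ k"
    then show "j = k mod d"
      using * d(1) unfolding d(2)
      by (intro inj_onD[OF primitive_element_inj_on[OF a]]) (auto simp: d_def)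
  qed
  then show ?thesis
    using power_mod_exponent[OF ud, of k] unfolding phi_def Let_def u_def[symmetric] by simp
qed

section \<open>Multiplicative characters\<close>

text \<open>The value 0 at 0 keeps the map multiplicative on the whole field, so sums can run over
  \<open>UNIV\<close>.\<close>

locale mult_character =
  fixes \<eta> :: "'a::{field,finite} \<Rightarrow> 'b::field"
  assumes zero [simp]: "\<eta> 0 = 0"
    and one [simp]: "\<eta> 1 = 1"
    and mult: "\<eta> (y * z) = \<eta> y * \<eta> z"
    and nontrivial: "\<exists>g. g \<noteq> 0 \<and> \<eta> g \<noteq> 1"
begin

lemma eq_0_iff [simp]: "\<eta> y = 0 \<longleftrightarrow> y = 0"
proof
  assume "\<eta> y = 0"
  then have "\<eta> (y * inverse y) = 0"
    by (simp add: mult)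
  then show "y = 0"
    by (cases "y = 0") auto
qed simp

lemma divide: "\<eta> (y / z) = \<eta> y / \<eta> z"
  using mult[of "y / z" z] by (cases "z = 0") (auto simp: field_simps)

lemma power: "\<eta> (y ^ n) = \<eta> y ^ n"
  by (induction n) (auto simp: mult)

text \<open>Replacing \<open>y\<close> by \<open>g * y\<close> multiplies the sum by
  \<open>\<eta> g\<close>, which differs from 1 for a suitable \<open>g\<close>.\<close>

lemma sum_eq_0: "(\<Sum>y\<in>UNIV. \<eta> y) = 0"
proof -
  obtain g where g: "g \<noteq> 0" "\<eta> g \<noteq> 1"
    using nontrivial by blast
  have "(\<Sum>y\<in>UNIV. \<eta> y) = (\<Sum>y\<in>UNIV. \<eta> (g * y))"
    by (rule sum.reindex_bij_betw[symmetric], rule bij_betwI[where g = "\<lambda>y. y / g"])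
      (use g in auto)
  also have "\<dots> = \<eta> g * (\<Sum>y\<in>UNIV. \<eta> y)"
    by (simp add: mult sum_distrib_left)
  finally show ?thesis
    using g(2) by simp
qed

end

section \<open>Character sums with values in characteristic 2\<close>

locale mult_character_char_2 = mult_character \<eta>
  for \<eta> :: "'a::{field,finite} \<Rightarrow> 'b::field" +
  assumes odd_CARD: "odd CARD('a)"
    and char_2: "(2 :: 'b) = 0"
begin

lemma add_self [simp]: "(z :: 'b) + z = 0"
  using char_2 by (metis mult_2 mult_zero_left)

lemma uminus_id [simp]: "- (z :: 'b) = z"
  using add_self[of z] by (metis minus_unique)

text \<open>The roots 1 and -1 coincide. Hence \<open>\<eta>\<close> is even, and its square stays
  nontrivial.\<close>

lemma square_eq_1: "z = 1" if "(z :: 'b)\<^sup>2 = 1"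
  using that by (auto simp: power2_eq_1_iff)

lemma minus [simp]: "\<eta> (- y) = \<eta> y"
proof -
  have "(\<eta> (- 1))\<^sup>2 = 1"
    by (simp flip: power)
  then show ?thesis
    using mult[of "- 1" y] square_eq_1 by simp
qed

lemma minus_commute: "\<eta> (y - z) = \<eta> (z - y)"
  using minus[of "y - z"] by simp

lemma two_nonzero: "(2 :: 'a) \<noteq> 0"
proof
  assume "(2 :: 'a) = 0"
  moreover obtain k where "CARD('a) = 2 * k + 1"
    using odd_CARD by (elim oddE)
  ultimately have "of_nat CARD('a) = (1 :: 'a)"
    by simp
  then show False
    by (simp add: of_nat_CARD_eq_0)
qed

lemma correlation: "(\<Sum>k\<in>UNIV. \<eta> (k - a) * \<eta> (k - b)) = (\<eta> (1 / 2))\<^sup>2 * (\<eta> (a - b))\<^sup>2"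
proof -
  define c where "c = (a + b) / 2"
  have double: "c + c = a + b"
    using two_nonzero by (simp add: c_def flip: mult_2)
  have "(\<Sum>k\<in>UNIV - {c}. \<eta> (k - a) * \<eta> (k - b)) = 0"
  \<comment> \<open>The reflection exchanges \<open>k - a\<close> and \<open>k - b\<close> up to
    sign. As \<open>\<eta>\<close> is even, paired terms are equal and add to 0; only the midpoint
    \<open>c\<close> is fixed.\<close>
  proof (rule sum_involution_eq_0[where h = "\<lambda>k. a + b - k"])
    fix k
    show "\<eta> (a + b - k - a) * \<eta> (a + b - k - b) + \<eta> (k - a) * \<eta> (k - b) = 0"
      using minus_commute[of k a] minus_commute[of k b] by (simp add: algebra_simps)
    assume k: "k \<in> UNIV - {c}"
    show "a + b - k \<noteq> k"
    proof
      assume "a + b - k = k"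
      then have "2 * k = 2 * c"
        unfolding mult_2 double by (simp add: diff_eq_eq)
      then have "k = c"
        using two_nonzero by simp
      then show False
        using k by simp
    qed
    show "a + b - k \<in> UNIV - {c}"
      using k double by (auto simp: algebra_simps)
  qed simp
  then have "(\<Sum>k\<in>UNIV. \<eta> (k - a) * \<eta> (k - b)) = \<eta> (c - a) * \<eta> (c - b)"
    by (subst sum.remove[of _ c]) auto
  also have "c - a = - (1 / 2 * (a - b))"
    using two_nonzero by (simp add: c_def field_simps)
  also have "c - b = 1 / 2 * (a - b)"
    using two_nonzero by (simp add: c_def field_simps)
  finally show ?thesis
    unfolding minus mult by (simp add: power2_eq_square)
qed

lemma of_nat_CARD_target: "of_nat CARD('a) = (1 :: 'b)"
proof -
  obtain k where "CARD('a) = 2 * k + 1"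
    using odd_CARD by (elim oddE)
  then show ?thesis
    by (simp add: char_2)
qed

text \<open>These are the entries of the product of the matrices with entries
  \<open>\<eta> (a - k)\<close> and \<open>1 / \<eta> (k - b)\<close>. The term at
  \<open>k = b\<close> is 0 because division by 0 gives 0.\<close>

lemma sum_divide:
  "(\<Sum>k\<in>UNIV. \<eta> (a - k) / \<eta> (k - b)) = (if a = b then 0 else 1)"
proof (cases "a = b")
  case True
  have "(\<Sum>k\<in>UNIV. \<eta> (a - k) / \<eta> (k - b)) = (\<Sum>k\<in>UNIV - {b}. 1)"
    using True minus_commute[of b] by (subst sum.remove[of _ b]) (auto intro!: sum.cong)
  also have "\<dots> = of_nat (CARD('a) - 1)"
    by (simp add: card_Diff_singleton)
  \<comment> \<open>\<open>CARD('a) - 1\<close> is even.\<close>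
  also have "\<dots> = 0"
    using of_nat_CARD_target by (subst of_nat_diff) auto
  finally show ?thesis
    using True by simp
next
  case False
  have "(\<Sum>k\<in>UNIV. \<eta> (a - k) / \<eta> (k - b)) = (\<Sum>k\<in>UNIV - {b}. \<eta> ((a - k) / (k - b)))"
    by (subst sum.remove[of _ b]) (auto simp: divide)
  \<comment> \<open>For \<open>a \<noteq> b\<close> the Moebius map taking \<open>k\<close> to
    \<open>(a - k) / (k - b)\<close> is injective and misses only -1. Its inverse comes from solving
    \<open>y * (k - b) = a - k\<close> for \<open>k\<close>.\<close>
  also have "\<dots> = (\<Sum>y\<in>UNIV - {- 1}. \<eta> y)"
  proof (rule sum.reindex_bij_betw, rule bij_betwI)
    show "(\<lambda>k. (a - k) / (k - b)) \<in> UNIV - {b} \<rightarrow> UNIV - {- 1}"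
      using False by (auto simp: field_simps)
    show "(\<lambda>y. (a + b * y) / (y + 1)) \<in> UNIV - {- 1} \<rightarrow> UNIV - {b}"
    proof
      fix y :: 'a assume "y \<in> UNIV - {- 1}"
      then have "y + 1 \<noteq> 0"
        by (metis Diff_iff add.commute minus_unique singletonI)
      then show "(a + b * y) / (y + 1) \<in> UNIV - {b}"
        using False by (auto simp: field_simps)
    qed
  next
    fix k assume "k \<in> UNIV - {b}"
    then have k: "k - b \<noteq> 0"
      by simp
    then have "(a - k) / (k - b) + 1 = (a - b) / (k - b)"
      by (simp add: field_simps)
    moreover have "a + b * ((a - k) / (k - b)) = k * (a - b) / (k - b)"
      using k by (simp add: field_simps)
    ultimately show "(a + b * ((a - k) / (k - b))) / ((a - k) / (k - b) + 1) = k"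
      using k False by simp
  next
    fix y :: 'a assume "y \<in> UNIV - {- 1}"
    then have y: "y + 1 \<noteq> 0"
      by (metis Diff_iff add.commute minus_unique singletonI)
    then have "a - (a + b * y) / (y + 1) = y * (a - b) / (y + 1)"
      by (simp add: field_simps)
    moreover have "(a + b * y) / (y + 1) - b = (a - b) / (y + 1)"
      using y by (simp add: field_simps)
    ultimately show "(a - (a + b * y) / (y + 1)) / ((a + b * y) / (y + 1) - b) = y"
      using y False by simp
  qed
  \<comment> \<open>The full sum is 0 and the omitted term is \<open>\<eta> (- 1) = 1\<close>, so
    the rest is -1, that is 1.\<close>
  also have "\<dots> = 1"
    using sum_eq_0 by (subst (asm) sum.remove[of _ "- 1"]) (auto simp: add_eq_0_iff)
  finally show ?thesis
    using False by simp
qed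

text \<open>Applying the matrix of \<open>sum_divide\<close> leaves, for each \<open>y\<close>, a
  zero sum of all \<open>c i\<close> with \<open>i \<noteq> y\<close>. The right side is free of
  \<open>y\<close>, so \<open>c\<close> is constant.\<close>

lemma kernel_constant:
  assumes "\<And>k. (\<Sum>i\<in>UNIV. c i * \<eta> (i - k)) = 0"
  shows "c y = (\<Sum>i\<in>UNIV. c i)"
proof -
  have "0 = (\<Sum>k\<in>UNIV. (\<Sum>i\<in>UNIV. c i * \<eta> (i - k)) / \<eta> (k - y))"
    using assms by simp
  also have "\<dots> = (\<Sum>k\<in>UNIV. \<Sum>i\<in>UNIV. c i * (\<eta> (i - k) / \<eta> (k - y)))"
    by (simp add: sum_divide_distrib)
  also have "\<dots> = (\<Sum>i\<in>UNIV. c i * (\<Sum>k\<in>UNIV. \<eta> (i - k) / \<eta> (k - y)))"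
    by (subst sum.swap) (simp add: sum_distrib_left)
  also have "\<dots> = (\<Sum>i\<in>UNIV - {y}. c i)"
    by (subst sum.remove[of _ y]) (auto simp: sum_divide)
  finally have "(\<Sum>i\<in>UNIV - {y}. c i) = 0" ..
  then show ?thesis
    by (subst sum.remove[of _ y]) auto
qed

lemma square:
  "mult_character_char_2 (\<lambda>y. (\<eta> y)\<^sup>2)"
proof
  obtain g where "g \<noteq> 0" "\<eta> g \<noteq> 1"
    using nontrivial by blast
  then show "\<exists>g. g \<noteq> 0 \<and> (\<eta> g)\<^sup>2 \<noteq> 1"
    using square_eq_1 by blast
qed (auto simp: mult power_mult_distrib odd_CARD char_2)

lemma square_kernel_iff:
  "(\<forall>k. (\<Sum>i\<in>UNIV. c i * (\<eta> (i - k))\<^sup>2) = 0) \<longleftrightarrow> (\<exists>z. \<forall>i. c i = z)"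
proof -
  interpret sq: mult_character_char_2 "\<lambda>y. (\<eta> y)\<^sup>2"
    by (rule square)
  show ?thesis
  proof
    assume "\<forall>k. (\<Sum>i\<in>UNIV. c i * (\<eta> (i - k))\<^sup>2) = 0"
    then show "\<exists>z. \<forall>i. c i = z"
      using sq.kernel_constant[of c] by blast
  next
    assume "\<exists>z. \<forall>i. c i = z"
    then obtain z where z: "\<And>i. c i = z"
      by blast
    have "(\<Sum>i\<in>UNIV. (\<eta> (i - k))\<^sup>2) = (\<Sum>i\<in>UNIV. (\<eta> i)\<^sup>2)" for k
      by (rule sum.reindex_bij_betw, rule bij_betwI[where g = "\<lambda>y. y + k"]) auto
    then show "\<forall>k. (\<Sum>i\<in>UNIV. c i * (\<eta> (i - k))\<^sup>2) = 0"
      by (simp add: z sq.sum_eq_0 flip: sum_distrib_left)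
  qed
qed

end

section \<open>Codes given by a generator matrix\<close>

lemma vector_matrix_mult_eq_sum_rows:
  fixes A :: "'b::comm_semiring_1 ^ 'n ^ 'k"
  shows "c v* A = (\<Sum>i\<in>UNIV. c $ i *s row i A)"
  by (simp add: vector_matrix_mult_def vec_eq_iff row_def)

lemma linear_vector_matrix_mult:
  "Vector_Spaces.linear (*s) (*s) (\<lambda>c. c v* (A :: 'b::field ^ 'n ^ 'k))"
  using matrix_vector_mul_linear_gen[of "transpose A"] unfolding transpose_matrix_vector .

text \<open>Describes codewords by coefficient vectors, so that dimensions can be computed among the
  coefficients.\<close>

lemma code_of_matrix_eq_range: "code_of_matrix G = range (\<lambda>c. c v* G)"
  unfolding code_of_matrix_def
proof
  have "vec.subspace (range (\<lambda>c. c v* G))"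
    using linear_vector_matrix_mult vec.subspace_UNIV by (rule vec.linear_subspace_image)
  moreover have "row i G = axis i 1 v* G" for i
    by (simp add: vector_matrix_mult_def row_def vec_eq_iff axis_def
        if_distrib[where f = "\<lambda>z. z * _"] cong: if_cong)
  then have "rows G \<subseteq> range (\<lambda>c. c v* G)"
    by (auto simp: rows_def)
  ultimately show "vec.span (rows G) \<subseteq> range (\<lambda>c. c v* G)"
    by (rule vec.span_minimal[rotated])
  have "row i G \<in> vec.span (rows G)" for i
    by (rule vec.span_base) (auto simp: rows_def)
  then show "range (\<lambda>c. c v* G) \<subseteq> vec.span (rows G)"
    unfolding vector_matrix_mult_eq_sum_rows by (auto intro!: vec.span_sum vec.span_scale)
qed

text \<open>Moving \<open>G\<close> across the bilinear form, \<open>c v* G\<close> is orthogonal to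
  every \<open>d v* G\<close> iff every \<open>d\<close> is orthogonal to
  \<open>c v* (G ** transpose G)\<close>. Unit vectors \<open>d\<close> then show that this vector
  is 0.\<close>

lemma code_hull_of_matrix:
  "code_hull (code_of_matrix G) = (\<lambda>c. c v* G) ` {c. c v* (G ** transpose G) = 0}"
proof -
  have "(\<Sum>l\<in>UNIV. (d v* G) $ l * (c v* G) $ l) = (\<Sum>j\<in>UNIV. d $ j * (c v* (G ** transpose G)) $ j)"
    for c d :: "'a ^ 'c"
  proof -
    have "(\<Sum>l\<in>UNIV. (d v* G) $ l * (c v* G) $ l) =
        (\<Sum>l\<in>UNIV. \<Sum>j\<in>UNIV. d $ j * (G $ j $ l * (c v* G) $ l))"
      by (simp add: vector_matrix_mult_def sum_distrib_right mult.assoc)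
    also have "\<dots> = (\<Sum>j\<in>UNIV. d $ j * (\<Sum>l\<in>UNIV. G $ j $ l * (c v* G) $ l))"
      by (subst sum.swap) (simp add: sum_distrib_left)
    also have "\<dots> = (\<Sum>j\<in>UNIV. d $ j * (c v* (G ** transpose G)) $ j)"
      by (simp add: matrix_vector_mult_def flip: vector_matrix_mul_assoc)
    finally show ?thesis .
  qed
  moreover have "(\<forall>d. (\<Sum>j\<in>UNIV. d $ j * e $ j) = 0) \<longleftrightarrow> e = 0" for e :: "'a ^ 'c"
  proof
    assume *: "\<forall>d. (\<Sum>j\<in>UNIV. d $ j * e $ j) = 0"
    have "e $ i = 0" for i
      using *[rule_format, of "axis i 1"] by (simp add: axis_def if_distrib[where f = "\<lambda>z. z * _"] cong: if_cong)
    then show "e = 0"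
      by (simp add: vec_eq_iff)
  qed simp
  ultimately show ?thesis
    by (auto simp: code_hull_def dual_code_def code_of_matrix_eq_range)
qed

lemma sum_UNIV_sum_type:
  "(\<Sum>l\<in>UNIV. f l) = (\<Sum>l\<in>UNIV. f (Inl l)) + (\<Sum>l\<in>UNIV. f (Inr l))"
  for f :: "'n::finite + 'm::finite \<Rightarrow> 'b::comm_monoid_add"
  by (simp add: sum.Plus comp_def flip: UNIV_Plus_UNIV)

lemma join_cols_gram:
  "join_cols A B ** transpose (join_cols A B) = A ** transpose A + B ** transpose B"
  by (simp add: vec_eq_iff matrix_matrix_mult_def transpose_def join_cols_def sum_UNIV_sum_type)

text \<open>The identity block copies \<open>c\<close> into the \<open>Inl\<close>
  coordinates.\<close>

lemma inj_join_cols_mat_1: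
  fixes B :: "'b::field ^ 'm ^ 'n"
  shows "inj (\<lambda>c. c v* join_cols (mat 1) B)"
proof (rule injI)
  fix c d :: "'b ^ 'n"
  assume eq: "c v* join_cols (mat 1) B = d v* join_cols (mat 1) B"
  have "(c v* join_cols (mat 1) B) $ Inl i = c $ i" for c :: "'b ^ 'n" and i
    by (simp add: vector_matrix_mult_def join_cols_def mat_def if_distrib cong: if_cong)
  then show "c = d"
    using eq by (metis vec_eq_iff)
qed

lemma dim_image_vector_matrix_mult:
  fixes G :: "'b::field ^ 'm ^ 'n"
  assumes "inj (\<lambda>c. c v* G)"
  shows "vec.dim ((\<lambda>c. c v* G) ` S) = vec.dim S"
  using vec.dim_image_eq[OF linear_vector_matrix_mult] assms inj_on_subset by blast

text \<open>With \<open>M\<close> the matrix of all \<open>\<eta> (x j - x i)\<close>, zero on the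
  diagonal, the diagonal value 1 gives \<open>P = M + mat 1\<close>. \<open>M\<close> is symmetric,
  so in the expanded product the cross terms cancel, the two identities cancel, and
  \<open>M ** transpose M\<close> is given by \<open>correlation\<close>.\<close>

lemma (in mult_character_char_2) gram_P_matrix:
  fixes x :: "'n::finite \<Rightarrow> 'a"
  assumes "bij x" "\<And>y. y \<noteq> 0 \<Longrightarrow> f y = \<eta> y"
  defines "P \<equiv> P_matrix f 1 x"
  shows "(mat 1 + P ** transpose P) $ i $ j = (\<eta> (1 / 2))\<^sup>2 * (\<eta> (x i - x j))\<^sup>2"
proof -
  have P: "P $ i $ j = \<eta> (x j - x i) + (if i = j then 1 else 0)" for i j
    using assms by (auto simp: P_matrix_def bij_def inj_eq)
  have "(P ** transpose P) $ i $ j = (\<Sum>k\<in>UNIV. \<eta> (x k - x i) * \<eta> (x k - x j))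
      + \<eta> (x j - x i) + \<eta> (x i - x j) + (if i = j then 1 else 0)"
    by (simp add: matrix_matrix_mult_def transpose_def P algebra_simps sum.distrib
        if_distrib[where f = "\<lambda>z. _ * z"] if_distrib[where f = "\<lambda>z. z * _"] cong: if_cong)
  also have "(\<Sum>k\<in>UNIV. \<eta> (x k - x i) * \<eta> (x k - x j)) = (\<Sum>y\<in>UNIV. \<eta> (y - x i) * \<eta> (y - x j))"
    using \<open>bij x\<close> by (rule sum.reindex_bij_betw)
  finally show ?thesis
    using minus_commute[of "x j" "x i"] by (simp add: correlation mat_def char_2)
qed

section \<open>The character attached to \<open>phi\<close> and the hull of its code\<close>

theorem theorem5p1:
  fixes r m N q s :: nat
    and \<alpha> :: "'a::{field,finite}"
    and \<beta> :: "'b::{field,finite}"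
    and x :: "'n::finite \<Rightarrow> 'a"
  assumes "prime r" and "odd r" and "m \<ge> 1"
    and "N > 1" and "N dvd r ^ m - 1"
    and "s \<ge> 1" and "q = 2 ^ s" and "N dvd q - 1"
    and "CARD('a) = r ^ m" and "CARD('b) = q"
    and "primitive_element \<alpha>" and "primitive_element \<beta>"
    and "bij x"
  shows "is_linear_code (2 * r ^ m) (r ^ m) (code_C (phi N \<alpha> \<beta>) 1 x) \<and>
         vec.dim (code_hull (code_C (phi N \<alpha> \<beta>) 1 x)) = 1"
proof -
  define u where "u = \<beta> ^ ((CARD('b) - 1) div N)"
  have phi: "phi N \<alpha> \<beta> (\<alpha> ^ k) = u ^ k" for k
    unfolding u_def using assms primitive_element_nonzero by (intro phi_power) auto
  have power: "\<exists>k. y = \<alpha> ^ k" if "y \<noteq> 0" for y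
    using \<open>primitive_element \<alpha>\<close> that unfolding primitive_element_def by blast
  have \<alpha>: "\<alpha> \<noteq> 0"
    using assms primitive_element_nonzero by blast
  \<comment> \<open>Otherwise the primitive \<open>\<beta>\<close> would have order at most
    \<open>(CARD('b) - 1) div N\<close>, too small for \<open>N > 1\<close>. This makes the
    character nontrivial.\<close>
  have "u \<noteq> 1"
  proof
    assume "u = 1"
    moreover have pos: "CARD('b) - 1 > 0"
      using CARD_field_ge_2[where 'a = 'b] by simp
    moreover have "(CARD('b) - 1) div N > 0"
      using assms(4,8,10) pos by (auto simp: div_greater_zero_iff dest: dvd_imp_le)
    ultimately have "CARD('b) - 1 \<le> (CARD('b) - 1) div N"
      using primitive_element_order_ge \<open>primitive_element \<beta>\<close> unfolding u_def by blast
    then show False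
      using pos \<open>N > 1\<close> div_less_dividend[of N "CARD('b) - 1"] by linarith
  qed
  define \<eta> where "\<eta> = (\<lambda>y. if y = 0 then 0 else phi N \<alpha> \<beta> y)"
  interpret mult_character_char_2 \<eta>
  proof
    show "\<eta> 0 = 0"
      by (simp add: \<eta>_def)
    show "\<eta> 1 = 1"
      using phi[of 0] by (simp add: \<eta>_def)
    show "\<eta> (y * z) = \<eta> y * \<eta> z" for y z
    proof (cases "y = 0 \<or> z = 0")
      case False
      then obtain i j where "y = \<alpha> ^ i" "z = \<alpha> ^ j"
        using power by metis
      then show ?thesis
        using phi \<alpha> by (simp add: \<eta>_def flip: power_add)
    qed (auto simp: \<eta>_def)
    show "\<exists>g. g \<noteq> 0 \<and> \<eta> g \<noteq> 1"
      using \<alpha> phi[of 1] \<open>u \<noteq> 1\<close> by (auto simp: \<eta>_def)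
    show "odd CARD('a)"
      using assms by simp
    show "(2 :: 'b) = 0"
      using of_nat_CARD_eq_0[where 'a = 'b] assms by simp
  qed
  define P where "P = P_matrix (phi N \<alpha> \<beta>) 1 x"
  define G where "G = join_cols (mat 1) P"
  have C: "code_C (phi N \<alpha> \<beta>) 1 x = code_of_matrix G"
    by (simp add: code_C_def G_def P_def)
  have inj: "inj (\<lambda>c. c v* G)"
    unfolding G_def by (rule inj_join_cols_mat_1)
  have CARD_n: "CARD('n) = r ^ m"
    using \<open>bij x\<close> \<open>CARD('a) = r ^ m\<close> bij_betw_same_card by metis
  have "is_linear_code (2 * r ^ m) (r ^ m) (code_of_matrix G)"
  proof -
    have "vec.dim (code_of_matrix G) = CARD('n)"
      unfolding code_of_matrix_eq_range dim_image_vector_matrix_mult[OF inj] by (rule vec_dim_card)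
    then show ?thesis
      by (simp add: is_linear_code_def CARD_n code_of_matrix_def)
  qed
  moreover have "vec.dim (code_hull (code_of_matrix G)) = 1"
  proof -
    have gram: "(G ** transpose G) $ i $ j = (\<eta> (1 / 2))\<^sup>2 * (\<eta> (x i - x j))\<^sup>2" for i j
      using gram_P_matrix[OF \<open>bij x\<close>, of "phi N \<alpha> \<beta>" i j]
      by (simp add: G_def P_def join_cols_gram \<eta>_def)
    have half: "\<eta> (1 / 2) \<noteq> 0"
      using two_nonzero by simp
    have "c v* (G ** transpose G) = 0 \<longleftrightarrow> c \<in> vec.span {1}" for c
    proof -
      have "(c v* (G ** transpose G)) $ j =
          (\<eta> (1 / 2))\<^sup>2 * (\<Sum>i\<in>UNIV. c $ i * (\<eta> (x i - x j))\<^sup>2)" for j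
        by (simp add: vector_matrix_mult_def gram sum_distrib_left mult_ac)
      \<comment> \<open>Transport along \<open>x\<close> from indices to field elements, where
        \<open>square_kernel_iff\<close> applies to \<open>c $ inv x y\<close> as a function of
        \<open>y\<close>.\<close>
      moreover have "(\<Sum>i\<in>UNIV. c $ i * (\<eta> (x i - x j))\<^sup>2) =
          (\<Sum>y\<in>UNIV. c $ inv x y * (\<eta> (y - x j))\<^sup>2)" for j
        using sum.reindex_bij_betw[OF \<open>bij x\<close>, of "\<lambda>y. c $ inv x y * (\<eta> (y - x j))\<^sup>2"] \<open>bij x\<close>
        by (simp add: bij_is_inj)
      ultimately have "c v* (G ** transpose G) = 0 \<longleftrightarrow>
          (\<forall>j. (\<Sum>y\<in>UNIV. c $ inv x y * (\<eta> (y - x j))\<^sup>2) = 0)"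
        using half by (simp add: vec_eq_iff)
      also have "\<dots> \<longleftrightarrow> (\<forall>k. (\<Sum>y\<in>UNIV. c $ inv x y * (\<eta> (y - k))\<^sup>2) = 0)"
        using \<open>bij x\<close> by (metis bij_pointE)
      also have "\<dots> \<longleftrightarrow> (\<exists>z. \<forall>y. c $ inv x y = z)"
        by (rule square_kernel_iff)
      also have "\<dots> \<longleftrightarrow> (\<exists>z. \<forall>i. c $ i = z)"
        using \<open>bij x\<close> by (metis bij_is_inj inv_f_f)
      also have "\<dots> \<longleftrightarrow> c \<in> vec.span {1}"
        by (auto simp: vec.span_singleton vec_eq_iff)
      finally show ?thesis .
    qed
    \<comment> \<open>Here \<open>1\<close> is the all-ones vector; encoding is injective, so its
      line keeps dimension 1.\<close>
    then have "code_hull (code_of_matrix G) = (\<lambda>c. c v* G) ` vec.span {1}"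
      by (simp add: code_hull_of_matrix)
    then show ?thesis
      by (simp add: dim_image_vector_matrix_mult[OF inj] vec.dim_span)
  qed
  ultimately show ?thesis
    by (simp add: C)
qed

end
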